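(* Let $R=k[x,y]$ be the polynomial ring in two variables over a field $k$. Every nonzero integrally closed monomial ideal of $R$ is $\omega$-linear.
   Context: $\mathbb{N}=\{1,2,\ldots\}$. For $N\in\mathbb{N}$, an ideal $I$ of a commutative ring $R$ with unity is $N$-absorbing if whenever $f_1,\ldots,f_{N+1}\in R$ satisfy $f_1\cdots f_{N+1}\in I$, there is some $j$ such that the product of the $f_i$ with $i\ne j$ lies in $I$. $\omega(I)$ is the least $N\in\mathbb{N}$ for which $I$ is $N$-absorbing, or $\infty$ if there is none; by convention $\omega(R)=0$. An ideal $I$ is $\omega$-linear if $\omega(I^m)=m\,\omega(I)$ for each $m\in\mathbb{N}$. A monomial ideal is an ideal generated by monomials. An element $f\in R$ is integral over an ideal $I$ if there are $\ell\in\mathbb{N}$ and $c_i\in I^i$ ($1\le i\le \ell$) with $f^{\ell}+c_1f^{\ell-1}+\cdots+c_{\ell-1}f+c_{\ell}=0$; the set $\overline{I}$ of elements integral over $I$ is the integral closure of $I$, and $I$ is integrally closed if $I=\overline{I}$. *)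

theory Defs
  imports
    "HOL-Computational_Algebra.Polynomial"
    "HOL-Library.Extended_Nat"
begin

text \<open>
  Ideals of a commutative ring are the submodules of the ring viewed as a module over itself,
  so ideals and generated ideals are the notions \<open>subspace\<close> and \<open>span\<close> of the locale
  \<open>module\<close> with ring multiplication as scalar multiplication.
\<close>

definition is_ideal :: "'r::comm_ring_1 set \<Rightarrow> bool" where
  "is_ideal I \<longleftrightarrow> module.subspace (*) I"

definition ideal_gen :: "'r::comm_ring_1 set \<Rightarrow> 'r set" where
  "ideal_gen S = module.span (*) S"

lemma module_times: "module ((*) :: 'r::comm_ring_1 \<Rightarrow> 'r \<Rightarrow> 'r)"
  by unfold_locales (simp_all add: algebra_simps)

lemma is_ideal_ideal_gen: "is_ideal (ideal_gen S)"
  unfolding is_ideal_def ideal_gen_def by (rule module.subspace_span[OF module_times])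

definition ideal_mult :: "'r::comm_ring_1 set \<Rightarrow> 'r set \<Rightarrow> 'r set" where
  "ideal_mult I J = ideal_gen {a * b | a b. a \<in> I \<and> b \<in> J}"

fun ideal_power :: "'r::comm_ring_1 set \<Rightarrow> nat \<Rightarrow> 'r set" where
  "ideal_power I 0 = UNIV"
| "ideal_power I (Suc m) = ideal_mult I (ideal_power I m)"

definition absorbing :: "nat \<Rightarrow> 'r::comm_ring_1 set \<Rightarrow> bool" where
  "absorbing N I \<longleftrightarrow> is_ideal I \<and>
     (\<forall>f :: nat \<Rightarrow> 'r. (\<Prod>i\<in>{1..N+1}. f i) \<in> I \<longrightarrow>
        (\<exists>j\<in>{1..N+1}. (\<Prod>i\<in>{1..N+1} - {j}. f i) \<in> I))"

text \<open>The infimum of the empty set in \<^typ>\<open>enat\<close> is \<open>\<infinity>\<close>.\<close>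

definition omega :: "'r::comm_ring_1 set \<Rightarrow> enat" where
  "omega I = (if I = UNIV then 0 else Inf {enat N | N. N \<ge> 1 \<and> absorbing N I})"

definition omega_linear :: "'r::comm_ring_1 set \<Rightarrow> bool" where
  "omega_linear I \<longleftrightarrow> is_ideal I \<and> (\<forall>m\<ge>1. omega (ideal_power I m) = enat m * omega I)"

definition integral_over :: "'r::comm_ring_1 \<Rightarrow> 'r set \<Rightarrow> bool" where
  "integral_over f I \<longleftrightarrow>
     (\<exists>l\<ge>1. \<exists>c :: nat \<Rightarrow> 'r. (\<forall>i\<in>{1..l}. c i \<in> ideal_power I i) \<and>
        f ^ l + (\<Sum>i\<in>{1..l}. c i * f ^ (l - i)) = 0)"

definition integral_closure :: "'r::comm_ring_1 set \<Rightarrow> 'r set" where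
  "integral_closure I = {f. integral_over f I}"

definition integrally_closed :: "'r::comm_ring_1 set \<Rightarrow> bool" where
  "integrally_closed I \<longleftrightarrow> I = integral_closure I"

text \<open>
  The ring \<open>k[x,y]\<close> is represented as \<open>k[x][y]\<close>, i.e. by the type \<open>'k poly poly\<close>: the inner
  indeterminate is \<open>x\<close>, the outer one is \<open>y\<close>, and \<open>monom2 a b\<close> is \<open>x\<^sup>a y\<^sup>b\<close>.
\<close>

definition monom2 :: "nat \<Rightarrow> nat \<Rightarrow> 'k::field poly poly" where
  "monom2 a b = monom (monom 1 a) b"

definition monomial_ideal :: "'k::field poly poly set \<Rightarrow> bool" where
  "monomial_ideal I \<longleftrightarrow> (\<exists>S. S \<subseteq> {monom2 a b | a b. True} \<and> I = ideal_gen S)"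

end

theory Submission
  imports Defs "HOL-Library.Set_Algebras" "HOL-Library.Product_Plus"
begin

text \<open>
  The proof computes \<open>\<omega>\<close> of a nonzero integrally closed monomial ideal \<open>I\<close> and of all its powers
  by one explicit formula that is visibly linear in the exponent of the power.

  Let \<open>x\<^sup>a\<close> and \<open>y\<^sup>b\<close> be the largest powers of the variables that divide all of \<open>I\<close>. Some
  \<open>x\<^bsup>p\<^esup> y\<^sup>b\<close> and some \<open>x\<^sup>a y\<^bsup>q\<^esup>\<close> lie in \<open>I\<close>; take \<open>p\<close> and \<open>q\<close> least and put
  \<open>d = max (p - a) (q - b)\<close>. Then \<open>x\<^bsup>a+d\<^esup> y\<^sup>b\<close> and \<open>x\<^sup>a y\<^bsup>b+d\<^esup>\<close> lie in \<open>I\<close>, and for \<open>s + t = d\<close>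
  the \<open>d\<close>-th power of \<open>x\<^bsup>a+s\<^esup> y\<^bsup>b+t\<^esup>\<close> is the product of \<open>s\<close> copies of the first and \<open>t\<close> copies of
  the second, hence is in \<open>I\<^sup>d\<close>. Integral closedness therefore puts the whole segment between the
  two corners into \<open>I\<close> (lemma \<open>integrally_closed_obtain_staircase\<close>). So \<open>I\<close> contains every
  monomial of degree at least \<open>a + b + d\<close> that is divisible by \<open>x\<^sup>a y\<^sup>b\<close>, while along at least one
  of the two edges, the row \<open>y\<^sup>b\<close> or the column \<open>x\<^sup>a\<close>, nothing of smaller degree is in \<open>I\<close>. It is
  this last property that can fail for other monomial ideals, where the missing monomial of largest
  degree may lie strictly inside the quadrant.

  For an ideal with these properties \<open>\<omega>(I) = a + b + d\<close> (lemma \<open>omega_staircase\<close>). The upper bound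
  holds because \<open>a\<close> of the factors suffice to make a product divisible by \<open>x\<^sup>a\<close>, and \<open>b\<close> of them
  to make it divisible by \<open>y\<^sup>b\<close>, so any other factor may be dropped, the degree taking care of the
  rest. For the lower bound, if \<open>d > 0\<close> and \<open>x\<^sup>s y\<^sup>t\<close> is the missing monomial of degree \<open>a + b + d - 1\<close> at the
  end of an edge, no factor can be dropped from \<open>x \<cdots> x \<cdot> y \<cdots> y \<cdot> (x + y)\<close>;
  if \<open>d = 0\<close>, the ideal is generated by \<open>x\<^sup>a y\<^sup>b\<close>, whose own factorization serves.

  Finally the properties are additive in \<open>(a, b, d)\<close> under products of ideals, as long as both
  ideals are tight along the same edge. Hence \<open>I\<^sup>m\<close> has them with \<open>(m a, m b, m d)\<close>, and
  \<open>\<omega>(I\<^sup>m) = m (a + b + d)\<close>.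
\<close>

section \<open>Monomial ideals as up-closed sets of exponents\<close>

definition supp :: "'k::field poly poly \<Rightarrow> (nat \<times> nat) set" where
  "supp f = {(i, j). coeff (coeff f j) i \<noteq> 0}"

definition polys_on :: "(nat \<times> nat) set \<Rightarrow> 'k::field poly poly set" where
  "polys_on E = {f. supp f \<subseteq> E}"

definition up_closed :: "(nat \<times> nat) set \<Rightarrow> bool" where
  "up_closed E \<longleftrightarrow> (\<forall>u v. u \<in> E \<longrightarrow> u + v \<in> E)"

lemma polys_onD: "f \<in> polys_on E \<Longrightarrow> u \<in> supp f \<Longrightarrow> u \<in> E"
  by (auto simp: polys_on_def)

lemma polys_onI: "(\<And>u. u \<in> supp f \<Longrightarrow> u \<in> E) \<Longrightarrow> f \<in> polys_on E"
  by (auto simp: polys_on_def)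

lemma up_closedD:
  assumes "up_closed E" "(i, j) \<in> E" "i \<le> i'" "j \<le> j'"
  shows "(i', j') \<in> E"
proof -
  have "(i, j) + (i' - i, j' - j) \<in> E"
    using assms(1,2) unfolding up_closed_def by blast
  then show ?thesis using assms(3,4) by simp
qed

lemma set_plus_elim_pair:
  assumes "(i, j) \<in> E + F"
  obtains p q p' q' where "(p, q) \<in> E" "(p', q') \<in> F" "i = p + p'" "j = q + q'"
  using assms by (elim set_plus_elim) auto

lemma up_closed_plus:
  assumes "up_closed E"
  shows "up_closed (E + F)"
  unfolding up_closed_def
proof (intro allI impI)
  fix u v assume "u \<in> E + F"
  then obtain x y where "u = x + y" "x \<in> E" "y \<in> F" by (rule set_plus_elim)
  then have "(x + v) + y \<in> E + F" using assms unfolding up_closed_def by blast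
  then show "u + v \<in> E + F" by (simp add: \<open>u = x + y\<close> add_ac)
qed

lemma supp_monom2 [simp]: "supp (monom2 a b :: 'k::field poly poly) = {(a, b)}"
  by (auto simp: supp_def monom2_def split: if_splits)

lemma supp_0 [simp]: "supp 0 = {}"
  by (auto simp: supp_def)

lemma supp_add: "supp (f + g) \<subseteq> supp f \<union> supp g"
  by (auto simp: supp_def)

lemma coeff_coeff_mult:
  "coeff (coeff (f * g) j) i =
     (\<Sum>j'\<le>j. \<Sum>i'\<le>i. coeff (coeff f j') i' * coeff (coeff g (j - j')) (i - i'))"
  by (simp add: coeff_mult coeff_sum)

lemma supp_mult: "supp (f * g) \<subseteq> supp f + supp g"
proof
  fix u assume "u \<in> supp (f * g)"
  then obtain i j where u: "u = (i, j)" and nz: "coeff (coeff (f * g) j) i \<noteq> 0"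
    by (auto simp: supp_def)
  obtain j' where j': "j' \<le> j"
    "(\<Sum>i'\<le>i. coeff (coeff f j') i' * coeff (coeff g (j - j')) (i - i')) \<noteq> 0"
    using nz unfolding coeff_coeff_mult by (meson atMost_iff sum.not_neutral_contains_not_neutral)
  then obtain i' where i': "i' \<le> i" "coeff (coeff f j') i' * coeff (coeff g (j - j')) (i - i') \<noteq> 0"
    by (meson atMost_iff sum.not_neutral_contains_not_neutral)
  have "(i', j') + (i - i', j - j') \<in> supp f + supp g"
    using i' by (intro set_plus_intro) (auto simp: supp_def)
  then show "u \<in> supp f + supp g" using i' j' u by simp
qed

lemma polys_on_mult: "f \<in> polys_on E \<Longrightarrow> g \<in> polys_on F \<Longrightarrow> f * g \<in> polys_on (E + F)"
  unfolding polys_on_def using supp_mult[of f g] set_plus_mono2[of "supp f" E "supp g" F] by blast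

lemma monom2_mult: "monom2 a b * monom2 c d = monom2 (a + c) (b + d)"
  by (simp add: monom2_def mult_monom)

lemma monom2_power: "monom2 a b ^ n = monom2 (n * a) (n * b)"
  by (simp add: monom2_def monom_power mult.commute)

text \<open>
  The coefficients are written as constant polynomials, so that each summand is visibly a ring
  multiple of a monomial and membership in an ideal can be read off from the monomials.
\<close>

lemma poly_as_sum_of_monom2:
  "f = (\<Sum>j\<le>degree f. \<Sum>i\<le>degree (coeff f j). [:[:coeff (coeff f j) i:]:] * monom2 i j)"
proof -
  have "(\<Sum>i\<le>degree p. [:[:coeff p i:]:] * monom2 i j) = monom p j" for p :: "'a poly" and j
  proof -
    have "(\<Sum>i\<le>degree p. [:[:coeff p i:]:] * monom2 i j) = (\<Sum>i\<le>degree p. monom (monom (coeff p i) i) j)"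
      by (simp add: monom2_def smult_monom)
    also have "\<dots> = monom (\<Sum>i\<le>degree p. monom (coeff p i) i) j"
      by (intro poly_eqI) (simp add: coeff_sum)
    finally show ?thesis by (simp add: poly_as_sum_of_monoms)
  qed
  then show ?thesis by (simp add: poly_as_sum_of_monoms)
qed

lemma is_ideal_iff:
  "is_ideal I \<longleftrightarrow> 0 \<in> I \<and> (\<forall>f\<in>I. \<forall>g\<in>I. f + g \<in> I) \<and> (\<forall>c. \<forall>f\<in>I. c * f \<in> I)"
  unfolding is_ideal_def by (simp add: module.subspace_def[OF module_times])

lemma is_ideal_polys_on:
  assumes "up_closed E"
  shows "is_ideal (polys_on E)"
proof -
  have "UNIV + E \<subseteq> E"
    using assms unfolding up_closed_def by (metis add.commute set_plus_elim subsetI)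
  then have "c * f \<in> polys_on E" if "f \<in> polys_on E" for c f :: "'k::field poly poly"
    using polys_on_mult[of c UNIV f E] that by (auto simp: polys_on_def)
  then show ?thesis
    unfolding is_ideal_iff by (auto simp: polys_on_def dest!: subsetD[OF supp_add])
qed

lemma ideal_sum: "is_ideal I \<Longrightarrow> (\<And>i. i \<in> A \<Longrightarrow> f i \<in> I) \<Longrightarrow> sum f A \<in> I"
  by (induction A rule: infinite_finite_induct) (auto simp: is_ideal_iff)

lemma polys_on_subset_ideal:
  assumes "is_ideal I" and "\<And>i j. (i, j) \<in> E \<Longrightarrow> monom2 i j \<in> I"
  shows "polys_on E \<subseteq> I"
proof
  fix f :: "'a poly poly" assume f: "f \<in> polys_on E"
  define t where "t i j = [:[:coeff (coeff f j) i:]:] * monom2 i j" for i j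
  have "t i j \<in> I" for i j
  proof (cases "coeff (coeff f j) i = 0")
    case True
    then show ?thesis using assms(1) by (simp add: t_def is_ideal_iff)
  next
    case False
    then have "(i, j) \<in> E" using polys_onD[OF f, of "(i, j)"] by (simp add: supp_def)
    then have "monom2 i j \<in> I" by (rule assms(2))
    then show ?thesis using assms(1) unfolding t_def is_ideal_iff by blast
  qed
  then have "(\<Sum>j\<le>degree f. \<Sum>i\<le>degree (coeff f j). t i j) \<in> I"
    by (intro ideal_sum[OF assms(1)])
  then show "f \<in> I" using poly_as_sum_of_monom2[of f] unfolding t_def by argo
qed

lemma ideal_gen_minimal: "S \<subseteq> I \<Longrightarrow> is_ideal I \<Longrightarrow> ideal_gen S \<subseteq> I"
  unfolding ideal_gen_def is_ideal_def by (rule module.span_minimal[OF module_times])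

lemma ideal_gen_superset: "S \<subseteq> ideal_gen S"
  unfolding ideal_gen_def by (rule module.span_superset[OF module_times])

text \<open>
  A polynomial lies in a monomial ideal iff all its monomials do, and this is what turns statements
  about monomial ideals into statements about subsets of the quadrant.
\<close>

lemma monomial_ideal_obtain_exponents:
  fixes I :: "'k::field poly poly set"
  assumes "monomial_ideal I"
  obtains E where "up_closed E" "I = polys_on E"
proof -
  obtain S :: "'k poly poly set"
    where S: "S \<subseteq> {monom2 a b | a b. True}" and I: "I = ideal_gen S"
    using assms unfolding monomial_ideal_def by blast
  define E where "E = {u + v | u v. case_prod monom2 u \<in> S}"
  have up: "up_closed E"
    unfolding up_closed_def E_def by (auto) (metis add.assoc add_Pair)
  have "S \<subseteq> polys_on E"
  proof
    fix f assume f: "f \<in> S"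
    then obtain a b where "f = monom2 a b" using S by blast
    moreover have "(a, b) = (a, b) + (0, 0)" by simp
    ultimately show "f \<in> polys_on E" using f unfolding E_def polys_on_def by force
  qed
  then have "I \<subseteq> polys_on E"
    unfolding I by (rule ideal_gen_minimal[OF _ is_ideal_polys_on[OF up]])
  moreover have "polys_on E \<subseteq> I"
  proof (rule polys_on_subset_ideal)
    show ideal: "is_ideal I" unfolding I by (rule is_ideal_ideal_gen)
    fix i j assume "(i, j) \<in> E"
    then obtain a b c d where "i = a + c" "j = b + d" "monom2 a b \<in> S"
      unfolding E_def by auto
    then show "monom2 i j \<in> I"
      using ideal ideal_gen_superset[of S] unfolding I is_ideal_iff
      by (metis add.commute monom2_mult subsetD)
  qed
  ultimately show ?thesis using that up by blast
qed

lemma ideal_mult_polys_on: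
  assumes "up_closed E" "up_closed F"
  shows "ideal_mult (polys_on E) (polys_on F) = (polys_on (E + F) :: 'k::field poly poly set)"
proof
  show "ideal_mult (polys_on E) (polys_on F) \<subseteq> (polys_on (E + F) :: 'k poly poly set)"
    unfolding ideal_mult_def using polys_on_mult
    by (intro ideal_gen_minimal is_ideal_polys_on up_closed_plus[OF assms(1)]) blast
  show "(polys_on (E + F) :: 'k poly poly set) \<subseteq> ideal_mult (polys_on E) (polys_on F)"
  proof (rule polys_on_subset_ideal)
    show "is_ideal (ideal_mult (polys_on E) (polys_on F) :: 'k poly poly set)"
      unfolding ideal_mult_def by (rule is_ideal_ideal_gen)
    fix i j assume "(i, j) \<in> E + F"
    then obtain a b c d where ij: "(a, b) \<in> E" "(c, d) \<in> F" "i = a + c" "j = b + d"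
      by (elim set_plus_elim) auto
    then have "monom2 a b \<in> polys_on E" "monom2 c d \<in> polys_on F"
      by (auto simp: polys_on_def)
    then have "monom2 a b * monom2 c d \<in> ideal_mult (polys_on E) (polys_on F :: 'k poly poly set)"
      unfolding ideal_mult_def using ideal_gen_superset by fast
    then show "monom2 i j \<in> ideal_mult (polys_on E) (polys_on F :: 'k poly poly set)"
      by (simp add: monom2_mult ij)
  qed
qed

text \<open>
  The value at \<open>0\<close> is the full quadrant, not the set \<open>{(0, 0)}\<close>, since it has to be the exponent set
  of the unit ideal; for up-closed \<open>E\<close> the two choices give the same sums from \<open>1\<close> on.
\<close>

primrec iter_plus :: "(nat \<times> nat) set \<Rightarrow> nat \<Rightarrow> (nat \<times> nat) set" where
  "iter_plus E 0 = UNIV"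
| "iter_plus E (Suc m) = E + iter_plus E m"

lemma up_closed_iter_plus: "up_closed E \<Longrightarrow> up_closed (iter_plus E m)"
  by (cases m) (auto intro: up_closed_plus simp: up_closed_def[of UNIV])

lemma ideal_power_polys_on:
  "up_closed E \<Longrightarrow> ideal_power (polys_on E) m = (polys_on (iter_plus E m) :: 'k::field poly poly set)"
proof (induction m)
  case 0
  show ?case by (simp add: polys_on_def)
qed (simp add: ideal_mult_polys_on up_closed_iter_plus)

lemma combination_in_iter_plus:
  assumes "(a, b) \<in> E" "(c, d) \<in> E"
  shows "(s * a + t * c, s * b + t * d) \<in> iter_plus E (s + t)"
proof (induction s)
  case 0
  show ?case
  proof (induction t)
    case (Suc t)
    then have "(c, d) + (t * c, t * d) \<in> E + iter_plus E t"
      using assms(2) by (intro set_plus_intro) auto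
    then show ?case by simp
  qed simp
next
  case (Suc s)
  then have "(a, b) + (s * a + t * c, s * b + t * d) \<in> E + iter_plus E (s + t)"
    using assms(1) by (intro set_plus_intro)
  then show ?case by (simp add: add_ac)
qed

section \<open>Staircases and their corners\<close>

text \<open>
  The set lies in the quadrant with corner \<open>(a, b)\<close> and contains all points of this quadrant at
  \<open>\<ell>\<^sub>1\<close>-distance at least \<open>d\<close> from the corner. Among the points that are closer nothing is prescribed;
  tightness, defined next, says that on the bottom row (or the left column) of the quadrant none of
  them belongs to the set, so that \<open>d\<close> is optimal and this is witnessed on an edge.
\<close>

definition staircase :: "(nat \<times> nat) set \<Rightarrow> nat \<Rightarrow> nat \<Rightarrow> nat \<Rightarrow> bool" where
  "staircase E a b d \<longleftrightarrow>
     (\<forall>i j. (i, j) \<in> E \<longrightarrow> a \<le> i \<and> b \<le> j) \<and>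
     (\<forall>i j. a \<le> i \<longrightarrow> b \<le> j \<longrightarrow> a + b + d \<le> i + j \<longrightarrow> (i, j) \<in> E)"

definition row_tight :: "(nat \<times> nat) set \<Rightarrow> nat \<Rightarrow> nat \<Rightarrow> nat \<Rightarrow> bool" where
  "row_tight E a b d \<longleftrightarrow> (\<forall>i. (i, b) \<in> E \<longrightarrow> a + d \<le> i)"

definition column_tight :: "(nat \<times> nat) set \<Rightarrow> nat \<Rightarrow> nat \<Rightarrow> nat \<Rightarrow> bool" where
  "column_tight E a b d \<longleftrightarrow> (\<forall>j. (a, j) \<in> E \<longrightarrow> b + d \<le> j)"

lemma staircase_lower: "staircase E a b d \<Longrightarrow> (i, j) \<in> E \<Longrightarrow> a \<le> i \<and> b \<le> j"
  unfolding staircase_def by blast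

lemma staircase_mem:
  "staircase E a b d \<Longrightarrow> a \<le> i \<Longrightarrow> b \<le> j \<Longrightarrow> a + b + d \<le> i + j \<Longrightarrow> (i, j) \<in> E"
  unfolding staircase_def by blast

text \<open>
  A point of the sum quadrant at distance at least \<open>d + d'\<close> from its corner splits: as much of the
  horizontal excess as possible, up to \<open>d\<close>, goes to the first summand, which is then filled up
  vertically to distance exactly \<open>d\<close>; the remainder is at distance at least \<open>d'\<close>.
\<close>

lemma staircase_plus:
  assumes E: "staircase E a b d" and F: "staircase F a' b' d'"
  shows "staircase (E + F) (a + a') (b + b') (d + d')"
  unfolding staircase_def
proof (intro conjI allI impI)
  fix i j assume "(i, j) \<in> E + F"
  then obtain p q p' q' where "i = p + p'" "j = q + q'" "(p, q) \<in> E" "(p', q') \<in> F"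
    by (elim set_plus_elim) auto
  then show "a + a' \<le> i" "b + b' \<le> j"
    using staircase_lower[OF E] staircase_lower[OF F] by (auto intro: add_mono)
next
  fix i j assume ij: "a + a' \<le> i" "b + b' \<le> j" "a + a' + (b + b') + (d + d') \<le> i + j"
  define p where "p = a + min d (i - (a + a'))"
  define q where "q = b + (d - min d (i - (a + a')))"
  have "(p, q) \<in> E" by (rule staircase_mem[OF E]) (auto simp: p_def q_def)
  moreover have "(i - p, j - q) \<in> F"
    by (rule staircase_mem[OF F]) (use ij in \<open>auto simp: p_def q_def min_def\<close>)
  ultimately have "(p, q) + (i - p, j - q) \<in> E + F" by (rule set_plus_intro)
  moreover have "p \<le> i" "q \<le> j" using ij by (auto simp: p_def q_def min_def)
  ultimately show "(i, j) \<in> E + F" by simp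
qed

text \<open>
  A point on the bottom row of the sum can only come from points on the two bottom rows, which is why
  tightness along an edge is additive while a gap inside the quadrant need not persist.
\<close>

lemma row_tight_plus:
  assumes E: "staircase E a b d" "row_tight E a b d" and F: "staircase F a' b' d'" "row_tight F a' b' d'"
  shows "row_tight (E + F) (a + a') (b + b') (d + d')"
  unfolding row_tight_def
proof (intro allI impI)
  fix i assume "(i, b + b') \<in> E + F"
  then obtain p q p' q' where *: "i = p + p'" "b + b' = q + q'" "(p, q) \<in> E" "(p', q') \<in> F"
    by (elim set_plus_elim) auto
  then have "q = b" "q' = b'"
    using staircase_lower[OF E(1) *(3)] staircase_lower[OF F(1) *(4)] by auto
  then show "a + a' + (d + d') \<le> i"
    using * E(2) F(2) unfolding row_tight_def by fastforce
qed

lemma column_tight_plus: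
  assumes E: "staircase E a b d" "column_tight E a b d"
    and F: "staircase F a' b' d'" "column_tight F a' b' d'"
  shows "column_tight (E + F) (a + a') (b + b') (d + d')"
  unfolding column_tight_def
proof (intro allI impI)
  fix j assume "(a + a', j) \<in> E + F"
  then obtain p q p' q' where *: "a + a' = p + p'" "j = q + q'" "(p, q) \<in> E" "(p', q') \<in> F"
    by (elim set_plus_elim) auto
  then have "p = a" "p' = a'"
    using staircase_lower[OF E(1) *(3)] staircase_lower[OF F(1) *(4)] by auto
  then show "b + b' + (d + d') \<le> j"
    using * E(2) F(2) unfolding column_tight_def by fastforce
qed

lemma staircase_iter_plus:
  assumes "staircase E a b d"
  shows "staircase (iter_plus E m) (m * a) (m * b) (m * d)"
proof (induction m)
  case (Suc m)
  then show ?case using staircase_plus[OF assms] by simp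
qed (simp add: staircase_def)

lemma row_tight_iter_plus:
  assumes "staircase E a b d" "row_tight E a b d"
  shows "row_tight (iter_plus E m) (m * a) (m * b) (m * d)"
proof (induction m)
  case (Suc m)
  then show ?case using row_tight_plus[OF assms staircase_iter_plus[OF assms(1)]] by simp
qed (simp add: row_tight_def)

lemma column_tight_iter_plus:
  assumes "staircase E a b d" "column_tight E a b d"
  shows "column_tight (iter_plus E m) (m * a) (m * b) (m * d)"
proof (induction m)
  case (Suc m)
  then show ?case using column_tight_plus[OF assms staircase_iter_plus[OF assms(1)]] by simp
qed (simp add: column_tight_def)

section \<open>The absorbing property of staircases\<close>

text \<open>
  As long as the factors chosen so far do not contribute \<open>p ^ Suc n\<close>, cancelling \<open>p ^ n\<close> shows that
  \<open>p\<close> divides one of the other factors; add that one.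
\<close>

lemma prime_elem_power_dvd_prod_subset:
  fixes p :: "'a::algebraic_semidom"
  assumes p: "prime_elem p" and A: "finite A" and dvd: "p ^ n dvd prod f A"
  shows "\<exists>B\<subseteq>A. card B \<le> n \<and> p ^ n dvd prod f B"
  using dvd
proof (induction n)
  case 0
  show ?case by (intro exI[of _ "{}"]) simp
next
  case (Suc n)
  have "p ^ n dvd prod f A" using Suc.prems by (auto intro: dvd_mult_right)
  then obtain B where B: "B \<subseteq> A" "card B \<le> n" "p ^ n dvd prod f B" using Suc.IH by blast
  show ?case
  proof (cases "p ^ Suc n dvd prod f B")
    case True
    then show ?thesis using B by (auto intro: le_SucI)
  next
    case False
    obtain g where g: "prod f B = p ^ n * g" using B(3) by blast
    obtain h where h: "prod f A = p ^ Suc n * h" using Suc.prems by blast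
    have "p ^ n * (g * prod f (A - B)) = p ^ n * (p * h)"
      using prod.subset_diff[OF B(1) A, of f] unfolding g h by (simp only: power_Suc mult_ac)
    then have "p dvd g * prod f (A - B)" using p by (metis dvd_triv_left mult_left_cancel power_not_zero prime_elem_not_zeroI)
    moreover have "\<not> p dvd g" using False g by (metis dvd_refl mult.commute mult_dvd_mono power_Suc)
    ultimately have "p dvd prod f (A - B)" using p by (auto simp: prime_elem_dvd_mult_iff)
    then obtain k where k: "k \<in> A - B" "p dvd f k"
      using prime_elem_dvd_prod_msetE[OF p, of "image_mset f (mset_set (A - B))"] A
      by (auto simp: prod_unfold_prod_mset)
    have fin: "finite B" using A B(1) by (rule finite_subset[rotated])
    have "p ^ Suc n dvd prod f (insert k B)"
      using k B(3) fin by (auto intro: mult_dvd_mono)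
    then show ?thesis using k B fin by (intro exI[of _ "insert k B"]) auto
  qed
qed

lemma prime_elem_x: "prime_elem (monom2 1 0 :: 'k::field poly poly)"
proof -
  have "prime_elem (monom 1 1 :: 'k poly)"
    by (rule prime_elemI) (auto simp: monom_1_dvd_iff' coeff_mult monom_1_dvd_iff'[of 1 1, simplified] is_unit_monom_0)
  then show ?thesis unfolding monom2_def monom_0 by (rule lift_prime_elem_poly)
qed

lemma prime_elem_y: "prime_elem (monom2 0 1 :: 'k::field poly poly)"
  unfolding monom2_def
  by (rule prime_elemI) (auto simp: monom_1_dvd_iff' coeff_mult)

lemma x_power_dvd_iff:
  "monom2 1 0 ^ a dvd f \<longleftrightarrow> (\<forall>i j. (i, j) \<in> supp f \<longrightarrow> a \<le> i)"
  unfolding monom2_power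
  by (simp add: monom2_def monom_0 const_poly_dvd_iff monom_1_dvd_iff' supp_def) (metis not_le)

lemma y_power_dvd_iff:
  "monom2 0 1 ^ b dvd f \<longleftrightarrow> (\<forall>i j. (i, j) \<in> supp f \<longrightarrow> b \<le> j)"
  unfolding monom2_power
  by (simp add: monom2_def monom_1_dvd_iff' supp_def poly_eq_iff) (metis not_le)

lemma supp_prod_degree:
  assumes "finite A" "\<And>k. k \<in> A \<Longrightarrow> (0, 0) \<notin> supp (f k)" "(i, j) \<in> supp (prod f A)"
  shows "card A \<le> i + j"
  using assms
proof (induction A arbitrary: i j rule: finite_induct)
  case (insert k A)
  then have "(i, j) \<in> supp (f k) + supp (prod f A)"
    using supp_mult[of "f k" "prod f A"] by auto
  then obtain p q p' q' where *: "(p, q) \<in> supp (f k)" "(p', q') \<in> supp (prod f A)" "i = p + p'" "j = q + q'"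
    by (rule set_plus_elim_pair)
  then have "card A \<le> p' + q'" using insert by auto
  moreover have "p + q \<noteq> 0" using *(1) insert.prems(1)[of k] by (metis add_is_0 insertI1)
  ultimately have "card A < i + j" using *(3,4) by linarith
  then show ?case using insert.hyps(1,2) by simp
qed auto

text \<open>
  Consider a monomial of \<open>g\<close> of least degree outside the ideal. In \<open>f * g\<close> it occurs multiplied by
  the constant term of \<open>f\<close>; any further contribution to the same exponent comes from a monomial of
  \<open>g\<close> of smaller degree, which is in the ideal and hence cannot divide a monomial outside it. So there
  is no cancellation. This makes factors outside the maximal ideal \<open>(x, y)\<close> behave as
  non-zero-divisors modulo the ideal.
\<close>

lemma cancel_nonzero_constant_term:
  assumes E: "up_closed E" and f: "(0, 0) \<in> supp f" and fg: "f * g \<in> polys_on E"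
  shows "g \<in> polys_on E"
proof -
  have "(i, j) \<in> supp g \<longrightarrow> (i, j) \<in> E" for i j
  proof (induction "i + j" arbitrary: i j rule: less_induct)
    case less
    show ?case
    proof (rule impI, rule ccontr)
      assume g: "(i, j) \<in> supp g" and notin: "(i, j) \<notin> E"
      define c where "c = coeff (coeff f 0) 0"
      define f' where "f' = f - [:[:c:]:]"
      have "(i, j) \<notin> supp (f' * g)"
      proof
        assume "(i, j) \<in> supp (f' * g)"
        then obtain p q p' q' where *: "(p, q) \<in> supp f'" "(p', q') \<in> supp g" "i = p + p'" "j = q + q'"
          using supp_mult[of f' g] by (blast elim: set_plus_elim_pair)
        have "(0, 0) \<notin> supp f'" by (simp add: supp_def f'_def c_def)
        then have "p + q \<noteq> 0" using *(1) by (metis add_is_0)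
        then have "(p', q') \<in> E" using less[of p' q'] * by auto
        then show False using notin up_closedD[OF E] * by auto
      qed
      moreover have "f * g = smult [:c:] g + f' * g" by (simp add: f'_def algebra_simps)
      ultimately have "(i, j) \<in> supp (f * g)"
        using f g by (auto simp: supp_def c_def)
      then show False using notin polys_onD[OF fg] by blast
    qed
  qed
  then show ?thesis by (auto intro: polys_onI)
qed

text \<open>
  If some factor has a nonzero constant term, drop that one. Otherwise every factor contributes at
  least one to the degree. At most \<open>a + b\<close> of the \<open>a + b + d + 1\<close> factors are needed to keep the
  product divisible by \<open>x\<^sup>a\<close> and \<open>y\<^sup>b\<close>; after dropping another one, all monomials of the product are
  in the quadrant and have degree at least \<open>a + b + d\<close>.
\<close>

lemma absorbing_staircase:
  assumes E: "up_closed E" and st: "staircase E a b d"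
  shows "absorbing (a + b + d) (polys_on E :: 'k::field poly poly set)"
  unfolding absorbing_def
proof (intro conjI allI impI)
  show "is_ideal (polys_on E :: 'k poly poly set)" by (rule is_ideal_polys_on[OF E])
  define N where "N = a + b + d"
  define A where "A = {1..N + 1}"
  have fin: "finite A" by (simp add: A_def)
  fix f :: "nat \<Rightarrow> 'k poly poly"
  assume "prod f {1..a + b + d + 1} \<in> polys_on E"
  then have prod: "prod f A \<in> polys_on E" by (simp add: A_def N_def)
  have "\<exists>k\<in>A. prod f (A - {k}) \<in> polys_on E"
  proof (cases "\<exists>k\<in>A. (0, 0) \<in> supp (f k)")
    case True
    then obtain k where k: "k \<in> A" "(0, 0) \<in> supp (f k)" by blast
    have "f k * prod f (A - {k}) \<in> polys_on E"
      using prod prod.remove[OF fin k(1), of f] by simp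
    then show ?thesis using cancel_nonzero_constant_term[OF E k(2)] k(1) by blast
  next
    case False
    have lower: "a \<le> i \<and> b \<le> j" if "(i, j) \<in> supp (prod f A)" for i j
      using staircase_lower[OF st] polys_onD[OF prod that] by blast
    obtain B where B: "B \<subseteq> A" "card B \<le> a" "monom2 1 0 ^ a dvd prod f B"
      using prime_elem_power_dvd_prod_subset[OF prime_elem_x fin, of a f] lower
      unfolding x_power_dvd_iff by blast
    obtain C where C: "C \<subseteq> A" "card C \<le> b" "monom2 0 1 ^ b dvd prod f C"
      using prime_elem_power_dvd_prod_subset[OF prime_elem_y fin, of b f] lower
      unfolding y_power_dvd_iff by blast
    have "card (B \<union> C) < card A"
      using card_Un_le[of B C] B(2) C(2) by (simp add: A_def N_def)
    then obtain k where k: "k \<in> A" "k \<notin> B" "k \<notin> C"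
      using B(1) C(1) by (metis Un_iff order_less_irrefl subsetI subset_antisym Un_least)
    have "prod f B dvd prod f (A - {k})" "prod f C dvd prod f (A - {k})"
      using k B(1) C(1) by (auto intro!: prod_dvd_prod_subset simp: fin)
    then have dvd: "monom2 1 0 ^ a dvd prod f (A - {k})" "monom2 0 1 ^ b dvd prod f (A - {k})"
      using B(3) C(3) by (auto intro: dvd_trans)
    have "prod f (A - {k}) \<in> polys_on E"
    proof (rule polys_onI)
      fix u assume u: "u \<in> supp (prod f (A - {k}))"
      obtain i j where ij: "u = (i, j)" by (cases u)
      have "card (A - {k}) \<le> i + j"
        using False u ij by (intro supp_prod_degree[of _ f]) (auto simp: fin)
      then have "a + b + d \<le> i + j" using k(1) by (simp add: A_def N_def)
      moreover have "a \<le> i" "b \<le> j"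
        using dvd u ij unfolding x_power_dvd_iff y_power_dvd_iff by auto
      ultimately show "u \<in> E" using staircase_mem[OF st] ij by blast
    qed
    then show ?thesis using k(1) by blast
  qed
  then show "\<exists>j\<in>{1..a + b + d + 1}. prod f ({1..a + b + d + 1} - {j}) \<in> polys_on E"
    by (simp add: A_def N_def)
qed

section \<open>Optimality and the value of omega\<close>

text \<open>
  Merge the last two factors into one and apply the hypothesis. If the merged factor is the one that
  can be dropped, then dropping only one of its two parts also works.
\<close>

lemma absorbing_Suc:
  assumes "absorbing n I"
  shows "absorbing (Suc n) I"
  unfolding absorbing_def
proof (intro conjI allI impI)
  show ideal: "is_ideal I" using assms by (simp add: absorbing_def)
  fix f :: "nat \<Rightarrow> 'a"
  assume f: "prod f {1..Suc n + 1} \<in> I"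
  define g where "g = f(n + 1 := f (n + 1) * f (n + 2))"
  have split: "prod h {1..n + 1} = h (n + 1) * prod h {1..n}" for h :: "nat \<Rightarrow> 'a"
    by (simp add: mult.commute)
  have gf: "prod g B = prod f B" if "B \<subseteq> {1..n}" for B
    using that by (intro prod.cong) (auto simp: g_def)
  have "prod f {1..Suc n + 1} = f (n + 2) * (f (n + 1) * prod f {1..n})"
    by (simp add: mult_ac)
  then have "prod g {1..n + 1} \<in> I"
    using f gf[of "{1..n}"] unfolding split by (simp add: g_def mult_ac)
  then obtain j where j: "j \<in> {1..n + 1}" "prod g ({1..n + 1} - {j}) \<in> I"
    using assms unfolding absorbing_def by blast
  show "\<exists>j\<in>{1..Suc n + 1}. prod f ({1..Suc n + 1} - {j}) \<in> I"
  proof (cases "j = n + 1")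
    case True
    then have "{1..n + 1} - {j} = {1..n}" by auto
    then have "f (n + 1) * prod f {1..n} \<in> I"
      using j(2) gf ideal unfolding is_ideal_iff by simp
    moreover have "{1..Suc n + 1} - {n + 2} = {1..n + 1}" by auto
    ultimately show ?thesis
      unfolding split[symmetric] by (intro bexI[of _ "n + 2"]) simp_all
  next
    case False
    define B where "B = {1..n} - {j}"
    have B: "B \<subseteq> {1..n}" "finite B" "{1..n + 1} - {j} = insert (n + 1) B"
      "{1..Suc n + 1} - {j} = insert (n + 2) (insert (n + 1) B)"
      using j(1) False by (auto simp: B_def)
    have "n + 1 \<notin> B" "n + 2 \<notin> B" by (auto simp: B_def)
    then have "prod f ({1..Suc n + 1} - {j}) = prod g ({1..n + 1} - {j})"
      unfolding B(3,4) using B(2) gf[OF B(1)] by (simp add: g_def mult_ac)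
    then show ?thesis using j by (intro bexI[of _ j]) auto
  qed
qed

lemma absorbing_mono: "n \<le> m \<Longrightarrow> absorbing n I \<Longrightarrow> absorbing m I"
  by (induction m rule: dec_induct) (auto intro: absorbing_Suc)

lemma omega_eqI:
  assumes "n \<ge> 1" "absorbing n I" "\<not> absorbing (n - 1) I"
  shows "omega I = enat n"
proof -
  have "I \<noteq> UNIV"
  proof
    assume "I = UNIV"
    then have "absorbing (n - 1) I" by (auto simp: absorbing_def is_ideal_iff)
    then show False using assms(3) by blast
  qed
  moreover have "n \<le> m" if "absorbing m I" for m
    using absorbing_mono[OF _ that, of "n - 1"] assms(1,3) by linarith
  then have "Inf {enat m | m. m \<ge> 1 \<and> absorbing m I} = enat n"
    using assms(1,2) by (intro antisym Inf_lower Inf_greatest) auto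
  ultimately show ?thesis by (simp add: omega_def)
qed

text \<open>
  The witness consists of \<open>s\<close> factors \<open>x\<close>, \<open>t\<close> factors \<open>y\<close> and one factor \<open>l\<close>; the hypotheses are the
  three ways of dropping a factor. Leaving \<open>l\<close> open covers both \<open>l = x + y\<close> and, for principal ideals,
  \<open>l = x\<close> or \<open>l = y\<close>.
\<close>

lemma not_absorbing_monom2_times:
  fixes l :: "'k::field poly poly"
  assumes "monom2 s t * l \<in> I" and l: "l \<noteq> 0"
    and st: "monom2 s t \<notin> I"
    and s: "s > 0 \<Longrightarrow> monom2 (s - 1) t * l \<notin> I"
    and t: "t > 0 \<Longrightarrow> monom2 s (t - 1) * l \<notin> I"
  shows "\<not> absorbing (s + t) I"
proof
  assume abs: "absorbing (s + t) I"
  define f where "f i = (if i \<le> s then monom2 1 0 else if i \<le> s + t then monom2 0 1 else l)" for i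
  have nz: "monom2 i j \<noteq> (0 :: 'k poly poly)" for i j by (simp add: monom2_def)
  have prods: "prod f {1..s} = monom2 s 0" "prod f {s + 1..s + t} = monom2 0 t"
    by (simp_all add: f_def monom2_power)
  have "prod f {1..s + t + 1} = prod f {1..s} * prod f {s + 1..s + t} * l"
    by (simp add: f_def prod.ub_add_nat)
  also have "\<dots> = monom2 s t * l" unfolding prods by (simp add: monom2_mult)
  finally have prod: "prod f {1..s + t + 1} = monom2 s t * l" .
  then obtain j where j: "j \<in> {1..s + t + 1}" "prod f ({1..s + t + 1} - {j}) \<in> I"
    using abs assms(1) unfolding absorbing_def by metis
  have rest: "f j * prod f ({1..s + t + 1} - {j}) = monom2 s t * l"
    using prod.remove[OF _ j(1), of f] prod by simp
  consider "j \<le> s" | "s < j" "j \<le> s + t" | "j = s + t + 1" using j(1) by fastforce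
  then show False
  proof cases
    case 1
    then have "s > 0" using j(1) by auto
    then have "monom2 1 0 * prod f ({1..s + t + 1} - {j}) = monom2 1 0 * (monom2 (s - 1) t * l)"
      using rest 1 by (simp add: f_def mult.assoc[symmetric] monom2_mult)
    then show False using j(2) s[OF \<open>s > 0\<close>] nz by (metis mult_left_cancel)
  next
    case 2
    then have "t > 0" by simp
    then have "monom2 0 1 * prod f ({1..s + t + 1} - {j}) = monom2 0 1 * (monom2 s (t - 1) * l)"
      using rest 2 by (simp add: f_def mult.assoc[symmetric] monom2_mult)
    then show False using j(2) t[OF \<open>t > 0\<close>] nz by (metis mult_left_cancel)
  next
    case 3
    then have "l * prod f ({1..s + t + 1} - {j}) = l * monom2 s t"
      using rest by (simp add: f_def mult.commute)
    then show False using j(2) st l by (metis mult_left_cancel)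
  qed
qed

lemma monom2_in_polys_on_iff: "monom2 i j \<in> polys_on E \<longleftrightarrow> (i, j) \<in> E"
  by (simp add: polys_on_def)

text \<open>
  With \<open>l = x + y\<close>, dropping any factor \<open>x\<close> or \<open>y\<close> from \<open>x\<^sup>s y\<^sup>t (x + y)\<close> leaves a binomial in which
  \<open>x\<^sup>s y\<^sup>t\<close> still occurs, and dropping \<open>x + y\<close> leaves \<open>x\<^sup>s y\<^sup>t\<close> itself. The coefficients are all \<open>1\<close>, so
  neither the characteristic nor the size of the field matters; powers of a general linear form
  can fail here, as \<open>(x + y)\<^bsup>p\<^esup> = x\<^bsup>p\<^esup> + y\<^bsup>p\<^esup>\<close> in characteristic \<open>p\<close>.
\<close>

lemma not_absorbing_missing_corner:
  assumes "(s, t) \<notin> E" "(s + 1, t) \<in> E" "(s, t + 1) \<in> E"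
  shows "\<not> absorbing (s + t) (polys_on E :: 'k::field poly poly set)"
proof -
  define l :: "'k poly poly" where "l = monom2 1 0 + monom2 0 1"
  have supp_l: "supp (monom2 i j * l) = {(i + 1, j), (i, j + 1)}" for i j
  proof -
    have "monom2 i j * l = monom2 (i + 1) j + monom2 i (j + 1)"
      by (simp only: l_def distrib_left monom2_mult add_0_right)
    then show ?thesis by (auto simp: supp_def monom2_def split: if_splits)
  qed
  have "l \<noteq> 0"
    using supp_l[of 0 0] by (metis insert_not_empty mult_zero_right supp_0)
  moreover have "monom2 s t * l \<in> polys_on E"
    using assms(2,3) by (simp add: polys_on_def supp_l)
  moreover have "monom2 (s - 1) t * l \<notin> polys_on E" if "s > 0"
    using assms(1) that by (simp add: polys_on_def supp_l)
  moreover have "monom2 s (t - 1) * l \<notin> polys_on E" if "t > 0"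
    using assms(1) that by (simp add: polys_on_def supp_l)
  ultimately show ?thesis
    using assms(1) by (intro not_absorbing_monom2_times[of _ _ l]) (auto simp: monom2_in_polys_on_iff)
qed

lemma omega_staircase:
  assumes E: "up_closed E" and st: "staircase E a b d"
    and tight: "row_tight E a b d \<or> column_tight E a b d"
  shows "omega (polys_on E :: 'k::field poly poly set) = enat (a + b + d)"
proof (cases "a + b + d = 0")
  case True
  then have "E = UNIV" using staircase_mem[OF st] by auto
  then have "polys_on E = (UNIV :: 'k poly poly set)" by (simp add: polys_on_def)
  then show ?thesis using True by (simp add: omega_def zero_enat_def)
next
  case False
  note abs = absorbing_staircase[OF E st, where 'k = 'k]
  have "\<not> absorbing (a + b + d - 1) (polys_on E :: 'k poly poly set)"
  proof (cases "d = 0")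
    case d: False
    \<comment> \<open>The last point before the end of the tight edge is missing, but its two successors are present.\<close>
    have "(a + d - 1, b) \<notin> E \<or> (a, b + d - 1) \<notin> E"
      using tight d unfolding row_tight_def column_tight_def by fastforce
    then obtain s t where "(s, t) \<notin> E" "s + t = a + b + d - 1" "a \<le> s" "b \<le> t"
      using that[of "a + d - 1" b] that[of a "b + d - 1"] d by linarith
    then show ?thesis
      using not_absorbing_missing_corner[of s t E] d staircase_mem[OF st] by simp
  next
    case d: True
    \<comment> \<open>Here the ideal is generated by \<open>x\<^sup>a y\<^sup>b\<close>, and no factor of \<open>x \<cdots> x \<cdot> y \<cdots> y\<close> can be dropped.\<close>
    have ab: "(a, b) \<in> E" using staircase_mem[OF st] d by simp
    have lower: "i < a \<or> j < b \<Longrightarrow> (i, j) \<notin> E" for i j using staircase_lower[OF st, of i j] by auto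
    have nz: "monom2 i j \<noteq> (0 :: 'k poly poly)" for i j by (simp add: monom2_def)
    show ?thesis
    proof (cases "a = 0")
      case a: False
      have "\<not> absorbing (a - 1 + b) (polys_on E :: 'k poly poly set)"
        by (rule not_absorbing_monom2_times[of _ _ "monom2 1 0"])
          (use a ab in \<open>auto simp: nz lower monom2_mult monom2_in_polys_on_iff\<close>)
      then show ?thesis using a d by simp
    next
      case a: True
      then have "b > 0" using False d by simp
      have "\<not> absorbing (a + (b - 1)) (polys_on E :: 'k poly poly set)"
        by (rule not_absorbing_monom2_times[of _ _ "monom2 0 1"])
          (use a \<open>b > 0\<close> ab in \<open>auto simp: nz lower monom2_mult monom2_in_polys_on_iff\<close>)
      then show ?thesis using \<open>b > 0\<close> d by simp
    qed
  qed
  then show ?thesis using False by (intro omega_eqI abs) auto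
qed

section \<open>Integrally closed monomial ideals\<close>

text \<open>
  The element \<open>f\<close> is a root of \<open>T ^ n - f ^ n\<close>, whose only lower coefficient lies in the \<open>n\<close>-th power of the
  ideal.
\<close>

lemma integrally_closed_root:
  assumes "integrally_closed I" "n \<ge> 1" "f ^ n \<in> ideal_power I n" and "\<And>i. is_ideal (ideal_power I i)"
  shows "f \<in> I"
proof -
  define c where "c i = (if i = n then - (f ^ n) else 0)" for i
  have "c i \<in> ideal_power I i" for i
  proof (cases "i = n")
    case True
    have "(- 1) * f ^ n \<in> ideal_power I n" using assms(3,4) unfolding is_ideal_iff by blast
    then show ?thesis using True by (simp add: c_def)
  next
    case False
    then show ?thesis using assms(4) by (simp add: c_def is_ideal_iff)
  qed
  moreover have "(\<Sum>i\<in>{1..n}. c i * f ^ (n - i)) = (\<Sum>i\<in>{n}. c i * f ^ (n - i))"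
    using assms(2) by (intro sum.mono_neutral_right) (auto simp: c_def)
  then have "f ^ n + (\<Sum>i\<in>{1..n}. c i * f ^ (n - i)) = 0" by (simp add: c_def)
  ultimately have "integral_over f I" unfolding integral_over_def using assms(2) by blast
  then show ?thesis using assms(1) unfolding integrally_closed_def integral_closure_def by blast
qed

text \<open>
  The longer of the two edges between the corner \<open>(a, b)\<close> and the first points of \<open>E\<close> on the axes of
  the quadrant determines \<open>d\<close>, and tightness along it is the minimality of that first point. All that
  integral closedness contributes is the segment joining \<open>(a + d, b)\<close> and \<open>(a, b + d)\<close>.
\<close>

lemma integrally_closed_obtain_staircase:
  assumes E: "up_closed E" "E \<noteq> {}"
    and closed: "integrally_closed (polys_on E :: 'k::field poly poly set)"
  obtains a b d where "staircase E a b d" "row_tight E a b d \<or> column_tight E a b d"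
proof -
  define a where "a = (LEAST i. \<exists>j. (i, j) \<in> E)"
  define b where "b = (LEAST j. \<exists>i. (i, j) \<in> E)"
  have lower: "a \<le> i" "b \<le> j" if "(i, j) \<in> E" for i j
    using that unfolding a_def b_def by (auto intro: Least_le)
  have "\<exists>i j. (i, j) \<in> E" "\<exists>j i. (i, j) \<in> E" using E(2) by auto
  then have ex_a: "\<exists>j. (a, j) \<in> E" and ex_b: "\<exists>i. (i, b) \<in> E"
    unfolding a_def b_def by - (rule LeastI_ex; assumption)+
  define p where "p = (LEAST i. (i, b) \<in> E)"
  define q where "q = (LEAST j. (a, j) \<in> E)"
  have p: "(p, b) \<in> E" "\<And>i. (i, b) \<in> E \<Longrightarrow> p \<le> i"
    unfolding p_def using ex_b by (auto intro: LeastI_ex Least_le)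
  have q: "(a, q) \<in> E" "\<And>j. (a, j) \<in> E \<Longrightarrow> q \<le> j"
    unfolding q_def using ex_a by (auto intro: LeastI_ex Least_le)
  have "a \<le> p" "b \<le> q" using lower p(1) q(1) by auto
  define d where "d = max (p - a) (q - b)"
  have "row_tight E a b d \<or> column_tight E a b d"
    unfolding row_tight_def column_tight_def d_def
    using p(2) q(2) \<open>a \<le> p\<close> \<open>b \<le> q\<close> by (cases "p - a \<ge> q - b") (auto simp: max_def)
  moreover have corners: "(a + d, b) \<in> E" "(a, b + d) \<in> E"
    using up_closedD[OF E(1) p(1)] up_closedD[OF E(1) q(1)] by (auto simp: d_def)
  have segment: "(a + s, b + t) \<in> E" if "s + t = d" for s t
    \<comment> \<open>An equation of integral dependence has positive degree, so \<open>d = 0\<close> is separate.\<close>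
  proof (cases "d = 0")
    case True
    then show ?thesis using that corners by simp
  next
    case False
    have "(s * (a + d) + t * a, s * b + t * (b + d)) \<in> iter_plus E (s + t)"
      by (rule combination_in_iter_plus[OF corners])
    also have "(s * (a + d) + t * a, s * b + t * (b + d)) = (d * (a + s), d * (b + t))"
      using that by (auto simp: algebra_simps)
    finally have "monom2 (a + s) (b + t) ^ d \<in> ideal_power (polys_on E :: 'k poly poly set) d"
      unfolding that ideal_power_polys_on[OF E(1)] monom2_power monom2_in_polys_on_iff .
    then have "monom2 (a + s) (b + t) \<in> (polys_on E :: 'k poly poly set)"
    proof (rule integrally_closed_root[OF closed, of d, rotated])
      show "d \<ge> 1" using False by simp
    qed (simp add: ideal_power_polys_on[OF E(1)] is_ideal_polys_on up_closed_iter_plus E(1))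
    then show ?thesis by (simp add: monom2_in_polys_on_iff)
  qed
  have "staircase E a b d"
    unfolding staircase_def
  proof (intro conjI allI impI)
    fix i j assume ij: "a \<le> i" "b \<le> j" "a + b + d \<le> i + j"
    define s where "s = min d (i - a)"
    have "(a + s, b + (d - s)) \<in> E" by (rule segment) (simp add: s_def)
    then show "(i, j) \<in> E"
      by (rule up_closedD[OF E(1)]) (use ij in \<open>auto simp: s_def min_def\<close>)
  qed (use lower in auto)
  ultimately show ?thesis using that by blast
qed

theorem corollary9:
  fixes I :: "'k::field poly poly set"
  assumes "monomial_ideal I"
    and "I \<noteq> {0}"
    and "integrally_closed I"
  shows "omega_linear I"
proof -
  obtain E where E: "up_closed E" and I: "I = polys_on E"
    by (rule monomial_ideal_obtain_exponents[OF assms(1)])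
  have "E \<noteq> {}"
  proof
    assume "E = {}"
    then have "f = 0" if "f \<in> I" for f
      using that by (auto simp: I polys_on_def supp_def poly_eq_iff)
    moreover have "0 \<in> I" by (simp add: I polys_on_def)
    ultimately show False using assms(2) by blast
  qed
  then obtain a b d where st: "staircase E a b d" and tight: "row_tight E a b d \<or> column_tight E a b d"
    using integrally_closed_obtain_staircase[OF E] assms(3) unfolding I by blast
  have "omega (ideal_power I m) = enat m * omega I" for m
  proof -
    have "omega (ideal_power I m) = enat (m * a + m * b + m * d)"
      unfolding I ideal_power_polys_on[OF E]
      using tight row_tight_iter_plus[OF st] column_tight_iter_plus[OF st]
      by (intro omega_staircase up_closed_iter_plus[OF E] staircase_iter_plus[OF st]) blast
    moreover have "omega I = enat (a + b + d)"
      unfolding I by (rule omega_staircase[OF E st tight])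
    ultimately show ?thesis by (simp add: algebra_simps)
  qed
  then show ?thesis
    unfolding omega_linear_def using is_ideal_polys_on[OF E] I by blast
qed

end
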